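(* Let $X$ be a Hausdorff locally convex topological vector space with dual $X^*$, $e$ an error function on $X\times X$, and $f:X\to\mathbb{R}\cup\{+\infty\}$ an $e$-convex function such that $e(x,x)=0$ for each $x\in\operatorname{dom} f$. Then for each $x\in\operatorname{dom} f$ and $x^*\in X^*$, $$x^*\in\partial^e f(x)\iff f^*_{e,x}(x^* )+f(x)=\langle x^*,x\rangle.$$ In particular, $(x,x^* )\in\operatorname{gr}(\partial^e f)$ implies $x\in\operatorname{dom} f$ and $x^*\in\operatorname{dom} f^*_{e,x}$.
   Context: For an extended-real-valued function $h$, $\operatorname{dom} h=\{h<+\infty\}$. An error function is a map $e:X\times X\to\mathbb{R}\cup\{+\infty\}$ that is nonnegative, symmetric, and has nonempty domain $\operatorname{dom} e=\{(x,y): e(x,y)<+\infty\}$. $f$ is $e$-convex if $\operatorname{dom} f\times\operatorname{dom} f\subset\operatorname{dom} e$ and $f(tx+(1-t)y)\le tf(x)+(1-t)f(y)+t(1-t)e(x,y)$ for all $x,y\in X$, $t\in\,]0,1[$. For fixed $y\in X$, the $(e,y)$-conjugate of $f$ is $f^*_{e,y}(x^* )=\sup_{x\in X}\{\langle x^*,x\rangle-f(x)-e(x,y)\}$, $x^*\in X^*$. The $e$-subdifferential of $f$ is $\partial^e f(x)=\{x^*\in X^*:\langle y-x,x^*\rangle\le f(y)-f(x)+e(x,y)\ \forall y\in X\}$ if $x\in\operatorname{dom} f$, and $\partial^e f(x)=\emptyset$ otherwise. The graph is $\operatorname{gr}(\partial^e f)=\{(x,x^* ): x^*\in\partial^e f(x)\}$.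 *)

theory Defs
  imports "HOL-Analysis.Analysis"
begin

text \<open>Real topological vector spaces that are Hausdorff and locally convex.  The type-class mechanism
  does not accept the constant \<open>convex\<close> in a class axiom, so convexity of \<open>V\<close> is unfolded in the last one;
  \<open>locally_convex_UNIV\<close> below recovers the formulation with library constants.\<close>

class hausdorff_lctvs = real_vector + topological_ab_group_add + t2_space +
  assumes tendsto_scaleR_nhds:
      "LIM p (nhds c \<times>\<^sub>F nhds x). fst p *\<^sub>R snd p :> nhds (c *\<^sub>R x)"
    and convex_nhds_base:
      "open W \<Longrightarrow> x \<in> W \<Longrightarrow>
         \<exists>U V. open U \<and>
           (\<forall>a\<in>V. \<forall>b\<in>V. \<forall>u\<ge>0. \<forall>v\<ge>0. u + v = 1 \<longrightarrow> u *\<^sub>R a + v *\<^sub>R b \<in> V) \<and>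
           x \<in> U \<and> U \<subseteq> V \<and> V \<subseteq> W"

lemma locally_convex_UNIV: "locally convex (UNIV :: 'a::hausdorff_lctvs set)"
  unfolding locally_def
proof (intro allI impI)
  fix W :: "'a set" and x
  assume "openin (top_of_set UNIV) W \<and> x \<in> W"
  then have "open W" "x \<in> W" by auto
  from convex_nhds_base[OF this]
  show "\<exists>U V. openin (top_of_set UNIV) U \<and> convex V \<and> x \<in> U \<and> U \<subseteq> V \<and> V \<subseteq> W"
    by (simp add: convex_def)
qed

instance real_normed_vector \<subseteq> hausdorff_lctvs
proof
  fix c :: real and x :: 'a
  have "((\<lambda>p. fst p *\<^sub>R snd p) \<longlongrightarrow> c *\<^sub>R x) (nhds c \<times>\<^sub>F nhds x)"
    by (intro tendsto_scaleR filterlim_fst filterlim_snd)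
  then show "LIM p (nhds c \<times>\<^sub>F nhds x). fst p *\<^sub>R snd p :> nhds (c *\<^sub>R x)" .
next
  fix W :: "'a set" and x
  assume "open W" "x \<in> W"
  then obtain r where "r > 0" "ball x r \<subseteq> W"
    by (auto simp: open_contains_ball)
  moreover have "convex (ball x r)" by (rule convex_ball)
  ultimately show "\<exists>U V. open U \<and>
      (\<forall>a\<in>V. \<forall>b\<in>V. \<forall>u\<ge>0. \<forall>v\<ge>0. u + v = 1 \<longrightarrow> u *\<^sub>R a + v *\<^sub>R b \<in> V) \<and>
      x \<in> U \<and> U \<subseteq> V \<and> V \<subseteq> W"
    unfolding convex_def[symmetric]
    by (intro exI[of _ "ball x r"]) auto
qed

typedef (overloaded) 'a topological_dual =
    "{\<phi> :: 'a::hausdorff_lctvs \<Rightarrow> real. linear \<phi> \<and> continuous_on UNIV \<phi>}"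
  morphisms pairing Abs_topological_dual
  by (rule exI[of _ "\<lambda>_. 0"]) (simp add: module_hom_zero)

definition effective_domain :: "('b \<Rightarrow> ereal) \<Rightarrow> 'b set" where
  "effective_domain h = {x. h x < \<infinity>}"

definition error_function :: "('a \<times> 'a \<Rightarrow> ereal) \<Rightarrow> bool" where
  "error_function e \<longleftrightarrow>
     (\<forall>x y. 0 \<le> e (x, y)) \<and> (\<forall>x y. e (x, y) = e (y, x)) \<and> effective_domain e \<noteq> {}"

text \<open>The functions \<open>f\<close> below are meant to take values in \<open>\<real> \<union> {\<infinity>}\<close>; with error functions being
  nonnegative, no expression of the form \<open>\<infinity> - \<infinity>\<close> then arises.\<close>

definition e_convex ::
    "('a::real_vector \<times> 'a \<Rightarrow> ereal) \<Rightarrow> ('a \<Rightarrow> ereal) \<Rightarrow> bool" where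
  "e_convex e f \<longleftrightarrow>
     effective_domain f \<times> effective_domain f \<subseteq> effective_domain e \<and>
     (\<forall>x y. \<forall>t\<in>{0<..<1::real}.
        f (t *\<^sub>R x + (1 - t) *\<^sub>R y)
          \<le> ereal t * f x + ereal (1 - t) * f y + ereal (t * (1 - t)) * e (x, y))"

definition e_conjugate ::
    "('a::hausdorff_lctvs \<times> 'a \<Rightarrow> ereal) \<Rightarrow> 'a \<Rightarrow> ('a \<Rightarrow> ereal) \<Rightarrow> 'a topological_dual \<Rightarrow> ereal" where
  "e_conjugate e y f x' = (SUP x. ereal (pairing x' x) - f x - e (x, y))"

definition e_subdifferential ::
    "('a::hausdorff_lctvs \<times> 'a \<Rightarrow> ereal) \<Rightarrow> ('a \<Rightarrow> ereal) \<Rightarrow> 'a \<Rightarrow> 'a topological_dual set" where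
  "e_subdifferential e f x =
     (if x \<in> effective_domain f
      then {x'. \<forall>y. ereal (pairing x' (y - x)) \<le> f y - f x + e (x, y)}
      else {})"

definition graph_of :: "('b \<Rightarrow> 'c set) \<Rightarrow> ('b \<times> 'c) set" where
  "graph_of F = {(x, y). y \<in> F x}"

end

theory Submission
  imports Defs
begin

text \<open>Since f(x) is finite, the subgradient inequality at x can be rearranged, for each y,
  into <x*,y> - f(y) - e(y,x) \<le> <x*,x> - f(x), using the symmetry of e. Taking the supremum over
  y, x* is an e-subgradient at x exactly when the conjugate at x* is at most <x*,x> - f(x)
  (\<open>e_conjugate_le_iff_e_subdifferential\<close>). The opposite inequality always holds,
  because y = x competes in the supremum and e(x,x) = 0 (\<open>e_conjugate_ge\<close>), so the
  bound is an equality. The upper bound is real, which gives the claim on the domains.\<close>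

lemma pairing_diff: "pairing x' (x - y) = pairing x' x - pairing x' y"
  using pairing[of x'] by (auto intro: linear_diff)

text \<open>For real a and b this is ordinary rearrangement. If a or b is \<infinity>, the first
  left side is -\<infinity> and the second right side is \<infinity>, so both inequalities
  hold.\<close>

lemma ereal_diff_le_iff_swap:
  fixes a b :: ereal
  assumes "a \<noteq> -\<infinity>" "b \<noteq> -\<infinity>"
  shows "ereal s - a - b \<le> ereal (p - r) \<longleftrightarrow> ereal (s - p) \<le> a - ereal r + b"
  using assms by (cases a; cases b) auto

text \<open>A supremum is below a bound iff every term is, and each term rearranges into the
  subgradient inequality at the same y. Nonnegativity of e keeps -\<infinity> out of the
  rearrangement.\<close>

lemma e_conjugate_le_iff_e_subdifferential:
  assumes e: "error_function e" and f: "\<And>y. f y \<noteq> -\<infinity>" and r: "f x = ereal r"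
  shows "e_conjugate e x f x' \<le> ereal (pairing x' x - r) \<longleftrightarrow> x' \<in> e_subdifferential e f x"
proof -
  have "e (y, x) \<noteq> -\<infinity>" "e (y, x) = e (x, y)" for y
    using e by (auto simp: error_function_def dest: spec[of _ y])
  then show ?thesis
    by (simp add: e_conjugate_def e_subdifferential_def effective_domain_def SUP_le_iff
        pairing_diff ereal_diff_le_iff_swap f r)
qed

lemma e_conjugate_ge:
  assumes "e (x, x) = 0" "f x = ereal r"
  shows "ereal (pairing x' x - r) \<le> e_conjugate e x f x'"
  unfolding e_conjugate_def using assms by (intro SUP_upper2[of x]) auto

theorem proposition11:
  fixes e :: "'a::hausdorff_lctvs \<times> 'a \<Rightarrow> ereal" and f :: "'a \<Rightarrow> ereal"
  assumes "error_function e"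
    and "\<And>x. f x \<noteq> -\<infinity>"
    and "e_convex e f"
    and "\<And>x. x \<in> effective_domain f \<Longrightarrow> e (x, x) = 0"
  shows "(\<forall>x \<in> effective_domain f. \<forall>x'.
            x' \<in> e_subdifferential e f x \<longleftrightarrow>
            e_conjugate e x f x' + f x = ereal (pairing x' x)) \<and>
         (\<forall>x x'. (x, x') \<in> graph_of (e_subdifferential e f) \<longrightarrow>
            x \<in> effective_domain f \<and> x' \<in> effective_domain (e_conjugate e x f))"
proof -
  have fin: "\<exists>r. f x = ereal r" if "x \<in> effective_domain f" for x
    using that assms(2)[of x] by (cases "f x") (auto simp: effective_domain_def)
  have "x' \<in> e_subdifferential e f x \<longleftrightarrow> e_conjugate e x f x' + f x = ereal (pairing x' x)"
    if x: "x \<in> effective_domain f" for x x'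
  proof -
    from fin[OF x] obtain r where r: "f x = ereal r" ..
    have "e_conjugate e x f x' \<le> ereal (pairing x' x - r) \<longleftrightarrow>
          e_conjugate e x f x' + f x = ereal (pairing x' x)"
      \<comment> \<open>The lower bound turns \<le> into equality and rules out the value
        -\<infinity>; if the conjugate is \<infinity>, both sides of the equivalence fail.\<close>
      using e_conjugate_ge[of e x f r x', OF assms(4)[OF x] r] r
      by (cases "e_conjugate e x f x'") auto
    then show ?thesis
      using e_conjugate_le_iff_e_subdifferential[of e f x r x', OF assms(1,2) r] by simp
  qed
  moreover have "x \<in> effective_domain f \<and> x' \<in> effective_domain (e_conjugate e x f)"
    if "x' \<in> e_subdifferential e f x" for x x'
  proof
    show x: "x \<in> effective_domain f"
      using that by (auto simp: e_subdifferential_def split: if_splits)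
    from fin[OF x] obtain r where r: "f x = ereal r" ..
    have "e_conjugate e x f x' \<le> ereal (pairing x' x - r)"
      using e_conjugate_le_iff_e_subdifferential[of e f x r x', OF assms(1,2) r] that by blast
    then show "x' \<in> effective_domain (e_conjugate e x f)"
      by (auto simp: effective_domain_def intro: le_less_trans)
  qed
  ultimately show ?thesis
    by (auto simp: graph_of_def)
qed

end
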